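(* Let $X$ be a metric space whose Hausdorff dimension $\mathrm{HD}(X)$ is finite. Then \[ D(X)\le \mathrm{t_DHD}(X)\le \lfloor \mathrm{HD}(X)\rfloor . \] Consequently, for every metric space $X$, $\mathrm{HD}(X)=+\infty$ whenever $\mathrm{t_DHD}(X)\ge\omega_0$.
   Context: $\mathrm{HD}$ is the classical Hausdorff dimension of a metric space, and $\mathrm{Ind}$ is the large inductive dimension, with $\mathrm{Ind}(\emptyset)=-1$. Values of $D$ and $\mathrm{t_DHD}$ lie in $\{-1\}\cup\mathbf{Ord}\cup\{\Omega\}$, ordered so that $-1<\alpha<\Omega$ for every ordinal $\alpha$. For an ordinal $\alpha$, $\lambda(\alpha)$ is the largest limit ordinal $\le\alpha$ ($0$ if there is none), and $n(\alpha)<\omega_0$ is the finite part: $\alpha=\lambda(\alpha)+n(\alpha)$. $D$-dimension (Henderson). $D(\emptyset)=-1$. For a nonempty metrizable space $X$, $D(X)$ is the smallest ordinal $\beta$, if any exists, such that $X=\bigcup\{A_\alpha:0\le\alpha\le\lambda(\beta)\}$ where: (i) each $A_\alpha$ is a closed subset of $X$ that is finite dimensional with respect to $\mathrm{Ind}$; (ii) for each $\delta$, $\bigcup\{A_\alpha:\delta\le\alpha\le\lambda(\beta)\}$ is closed in $X$; (iii) $n(\beta)=\mathrm{Ind}(A_{\lambda(\beta)})$, where $n(\beta)=0$ if $A_{\lambda(\beta)}=\emptyset$; (iv) for each $x\in X$ there is a largest $\delta\le\lambda(\beta)$ with $x\in A_\delta$. If no such $\beta$ exists, $D(X)=\Omega$.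 $D$-variant of transfinite Hausdorff dimension. For a metric space $X$, let $\mathcal L(X)$ be the collection of all Lipschitz maps $f:E\to Y$, where $E$ is a metric subspace of $X$ and $Y$ is any metric space; $\mathrm{Im}(f)=f(E)$. Then $\mathrm{t_DHD}(X)=\sup\{D(\mathrm{Im}(f)):f\in\mathcal L(X)\}$, set equal to $\Omega$ if there is no ordinal supremum; $\mathrm{t_DHD}(X)=-1$ if and only if $X=\emptyset$. *)

theory Defs
  imports "HOL-Analysis.Analysis"
begin

section \<open>Ordinals\<close>

text \<open>
  Ordinals are order types of well-orders. HOL has no single type of all ordinals; the order
  types of the well-orders whose field is a subset of a given type \<open>'b\<close> make up an initial
  segment of the class of all ordinals, namely the ordinals of cardinality at most \<open>|'b|\<close>.
\<close>

quotient_type 'b ordertype = "'b rel" / partial: "\<lambda>r s. (r, s) \<in> ordIso"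
proof (rule part_equivpI)
  show "\<exists>r :: 'b rel. (r, r) \<in> ordIso"
    using card_of_Well_order ordIso_reflexive by blast
  show "symp (\<lambda>r s :: 'b rel. (r, s) \<in> ordIso)"
    by (rule sympI) (rule ordIso_symmetric)
  show "transp (\<lambda>r s :: 'b rel. (r, s) \<in> ordIso)"
    by (rule transpI) (rule ordIso_transitive)
qed

instantiation ordertype :: (type) wellorder
begin

lift_definition less_eq_ordertype :: "'a ordertype \<Rightarrow> 'a ordertype \<Rightarrow> bool"
  is "\<lambda>r s. (r, s) \<in> ordLeq"
  by (meson ordIso_imp_ordLeq ordIso_symmetric ordLeq_transitive)

lift_definition less_ordertype :: "'a ordertype \<Rightarrow> 'a ordertype \<Rightarrow> bool"
  is "\<lambda>r s. (r, s) \<in> ordLess"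
  by (meson ordIso_ordLess_trans ordIso_symmetric ordLess_ordIso_trans)

instance
proof -
  have WO: "Well_order r" if "(r, r) \<in> ordIso" for r :: "'a rel"
    using that by (simp add: ordIso_def)
  have ax1: "(x < y) = (x \<le> y \<and> \<not> y \<le> x)" for x y :: "'a ordertype"
    by transfer (metis WO not_ordLeq_iff_ordLess ordLess_imp_ordLeq)
  have ax2: "x \<le> x" for x :: "'a ordertype"
    by transfer (rule ordIso_imp_ordLeq)
  have ax3: "x \<le> z" if "x \<le> y" "y \<le> z" for x y z :: "'a ordertype"
    using that by transfer (rule ordLeq_transitive)
  have ax4: "x = y" if "x \<le> y" "y \<le> x" for x y :: "'a ordertype"
    using that by transfer (simp add: ordIso_iff_ordLeq)
  have ax5: "x \<le> y \<or> y \<le> x" for x y :: "'a ordertype"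
    by transfer (metis WO ordLeq_total)
  have wf: "wf {(x, y :: 'a ordertype). x < y}"
  proof (rule wf_subset)
    show "wf (inv_image (ordLess :: ('a rel \<times> 'a rel) set) rep_ordertype)"
      by (rule wf_inv_image[OF wf_ordLess])
    show "{(x, y :: 'a ordertype). x < y} \<subseteq> inv_image ordLess rep_ordertype"
      by (auto simp: inv_image_def less_ordertype.rep_eq)
  qed
  show "OFCLASS('a ordertype, wellorder_class)"
  proof (intro_classes, goal_cases)
    case 1 show ?case by (rule ax1)
  next
    case 2 show ?case by (rule ax2)
  next
    case 3 then show ?case by (rule ax3)
  next
    case 4 then show ?case by (rule ax4)
  next
    case 5 show ?case by (rule ax5)
  next
    case (6 P a)
    with wf show ?case
      by (metis (no_types, lifting) case_prodI mem_Collect_eq wf_induct_rule)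
  qed
qed

end

instantiation ordertype :: (type) zero
begin

lift_definition zero_ordertype :: "'a ordertype" is "{}"
  using well_order_on_empty by (auto intro!: ordIso_reflexive)

instance ..

end

definition osucc :: "'b::wellorder \<Rightarrow> 'b" where
  "osucc \<alpha> = (LEAST \<gamma>. \<alpha> < \<gamma>)"

definition limit_ordinal :: "'b::wellorder \<Rightarrow> bool" where
  "limit_ordinal \<alpha> \<longleftrightarrow> (\<exists>\<beta>. \<beta> < \<alpha>) \<and> (\<forall>\<beta><\<alpha>. \<exists>\<gamma>. \<beta> < \<gamma> \<and> \<gamma> < \<alpha>)"

text \<open>
  The ordinals used for a space with underlying type \<open>'a\<close> are those of cardinality at most
  \<open>2 ^ \<kappa>\<close>, where \<open>\<kappa> = max |'a| \<aleph>\<^sub>0\<close>. This is large enough for both dimensions below to agree with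
  their definitions over the class of all ordinals.

  For \<open>D\<close>: let \<open>(A\<^sub>\<alpha>)\<close> be a decomposition as in \<open>D_decomposition\<close>, indexed by ordinals of any size,
  and let \<open>\<delta>(x)\<close> be the largest index of a set containing \<open>x\<close>. The sets \<open>A\<^sub>\<alpha>\<close> with
  \<open>\<alpha> \<in> T = {\<delta>(x) | x \<in> X}\<close>, reindexed by the order type of \<open>T\<close> and followed by empty sets up to and
  including the next limit ordinal, are again such a decomposition, and \<open>|T| \<le> |X|\<close>. Hence the
  least index \<open>\<beta>\<close>, if there is one, has cardinality at most \<open>\<kappa>\<close>.

  For the supremum in the transfinite Hausdorff dimension: a supremum of ordinals of cardinality
  at most \<open>\<kappa>\<close> is at most the cardinal successor of \<open>\<kappa>\<close>, which is at most \<open>2 ^ \<kappa>\<close>.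
\<close>

type_synonym 'a ord = "('a + nat) set ordertype"

definition ord_of_nat :: "nat \<Rightarrow> 'a ord" where
  "ord_of_nat n = (osucc ^^ n) 0"

definition omega0 :: "'a ord" where
  "omega0 = (LEAST \<alpha>. limit_ordinal \<alpha>)"

definition limit_part :: "'a ord \<Rightarrow> 'a ord" where
  "limit_part \<alpha> =
     (if \<exists>\<gamma>\<le>\<alpha>. limit_ordinal \<gamma> then (GREATEST \<gamma>. limit_ordinal \<gamma> \<and> \<gamma> \<le> \<alpha>) else 0)"

text \<open>The finite part of \<open>\<alpha>\<close>, that is the \<open>n\<close> with \<open>\<alpha> = limit_part \<alpha> + n\<close>.\<close>

definition finite_part :: "'a ord \<Rightarrow> nat" where
  "finite_part \<alpha> = (THE n. \<alpha> = (osucc ^^ n) (limit_part \<alpha>))"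

datatype 'o dimval = MinusOne | Ord 'o | \<Omega>

instantiation dimval :: (wellorder) wellorder
begin

fun less_eq_dimval :: "'a dimval \<Rightarrow> 'a dimval \<Rightarrow> bool" where
  "MinusOne \<le> y \<longleftrightarrow> True"
| "Ord a \<le> MinusOne \<longleftrightarrow> False"
| "Ord a \<le> Ord b \<longleftrightarrow> a \<le> b"
| "Ord a \<le> \<Omega> \<longleftrightarrow> True"
| "\<Omega> \<le> y \<longleftrightarrow> y = \<Omega>"

definition less_dimval :: "'a dimval \<Rightarrow> 'a dimval \<Rightarrow> bool" where
  "x < y \<longleftrightarrow> x \<le> y \<and> \<not> y \<le> (x :: 'a dimval)"

instance
proof
  fix x y z :: "'a dimval"
  show "x < y \<longleftrightarrow> x \<le> y \<and> \<not> y \<le> x" by (rule less_dimval_def)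
  show "x \<le> x" by (cases x) auto
  show "x \<le> z" if "x \<le> y" "y \<le> z" using that by (cases x; cases y; cases z) auto
  show "x = y" if "x \<le> y" "y \<le> x" using that by (cases x; cases y) auto
  show "x \<le> y \<or> y \<le> x" by (cases x; cases y) auto
next
  fix P :: "'a dimval \<Rightarrow> bool" and v
  assume step: "\<And>x. (\<And>y. y < x \<Longrightarrow> P y) \<Longrightarrow> P x"
  have m: "P MinusOne"
    by (rule step) (simp add: less_dimval_def)
  have o: "P (Ord a)" for a
  proof (induction a rule: less_induct)
    case (less a)
    show ?case
    proof (rule step)
      fix y assume "y < Ord a"
      then show "P y" using m less by (cases y) (auto simp: less_dimval_def)
    qed
  qed
  have "P \<Omega>"
  proof (rule step)
    fix y assume "y < (\<Omega> :: 'a dimval)"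
    then show "P y" using m o by (cases y) (auto simp: less_dimval_def)
  qed
  with m o show "P v" by (cases v) auto
qed

end


section \<open>Large inductive dimension\<close>

inductive Ind_le :: "'a topology \<Rightarrow> int \<Rightarrow> bool" where
  empty: "\<lbrakk>topspace X = {}; -1 \<le> n\<rbrakk> \<Longrightarrow> Ind_le X n"
| step: "\<lbrakk>0 \<le> n;
          \<And>F V. \<lbrakk>closedin X F; openin X V; F \<subseteq> V\<rbrakk> \<Longrightarrow>
            \<exists>U. openin X U \<and> F \<subseteq> U \<and> U \<subseteq> V \<and> Ind_le (subtopology X (X frontier_of U)) (n - 1)\<rbrakk>
         \<Longrightarrow> Ind_le X n"

definition Ind :: "'a topology \<Rightarrow> ereal" where
  "Ind X = (INF n \<in> {n. Ind_le X n}. ereal (real_of_int n))"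


section \<open>The \<open>D\<close>-dimension\<close>

definition D_decomposition :: "'a topology \<Rightarrow> 'a ord \<Rightarrow> ('a ord \<Rightarrow> 'a set) \<Rightarrow> bool" where
  "D_decomposition X \<beta> A \<longleftrightarrow>
     topspace X = (\<Union>\<alpha>\<in>{..limit_part \<beta>}. A \<alpha>) \<and>
     (\<forall>\<alpha>\<le>limit_part \<beta>. closedin X (A \<alpha>) \<and> Ind (subtopology X (A \<alpha>)) < \<infinity>) \<and>
     (\<forall>\<delta>. closedin X (\<Union>\<alpha>\<in>{\<delta>..limit_part \<beta>}. A \<alpha>)) \<and>
     (if A (limit_part \<beta>) = {} then finite_part \<beta> = 0
      else ereal (real (finite_part \<beta>)) = Ind (subtopology X (A (limit_part \<beta>)))) \<and>
     (\<forall>x\<in>topspace X. \<exists>\<delta>\<le>limit_part \<beta>. x \<in> A \<delta> \<and> (\<forall>\<gamma>\<le>limit_part \<beta>. x \<in> A \<gamma> \<longrightarrow> \<gamma> \<le> \<delta>))"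

definition D_dim :: "'a topology \<Rightarrow> 'a ord dimval" where
  "D_dim X =
     (if topspace X = {} then MinusOne
      else if \<exists>\<beta> A. D_decomposition X \<beta> A then Ord (LEAST \<beta>. \<exists>A. D_decomposition X \<beta> A)
      else \<Omega>)"


section \<open>The \<open>D\<close>-variant of transfinite Hausdorff dimension\<close>

text \<open>
  Target spaces \<open>Y\<close> range over the metric spaces with carrier in the type \<open>'a\<close> of \<open>X\<close>. This is no
  restriction: the image of \<open>f : E \<rightarrow> Y\<close> has at most as many points as \<open>E\<close>, so it is isometric to a
  metric space carried by a subset of \<open>E\<close> (see \<open>Lipschitz_image_transfer\<close>).
  Since \<open>\<Omega>\<close> is the top element, the least upper bound is \<open>\<Omega>\<close> if no ordinal is an upper bound.
\<close>

definition tDHD :: "'a metric \<Rightarrow> 'a ord dimval" where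
  "tDHD X =
     (LEAST v. \<forall>E (Y :: 'a metric) f.
        E \<subseteq> mspace X \<longrightarrow> Lipschitz_continuous_map (submetric X E) Y f \<longrightarrow>
        D_dim (mtopology_of (submetric Y (f ` E))) \<le> v)"

lemma Lipschitz_image_transfer:
  fixes X :: "'a metric" and Y :: "'b metric"
  assumes E: "E \<subseteq> mspace X" and f: "Lipschitz_continuous_map (submetric X E) Y f"
  obtains Y' :: "'a metric" and f' and h
  where "Lipschitz_continuous_map (submetric X E) Y' f'"
    and "bij_betw h (f ` E) (f' ` E)"
    and "\<And>x y. \<lbrakk>x \<in> f ` E; y \<in> f ` E\<rbrakk> \<Longrightarrow> mdist Y' (h x) (h y) = mdist Y x y"
proof -
  define h where "h = inv_into E f"
  define d where "d = (\<lambda>x y. mdist Y (f x) (f y))"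
  define M where "M = h ` f ` E"
  have fh: "f (h y) = y" if "y \<in> f ` E" for y
    using that by (simp add: h_def f_inv_into_f)
  have fE: "f ` E \<subseteq> mspace Y"
    using f E by (auto simp: Lipschitz_continuous_map_def Pi_iff)
  have inM: "f x \<in> mspace Y" if "x \<in> M" for x
    using that fh fE by (auto simp: M_def)
  have inj: "x = y" if "x \<in> M" "y \<in> M" "f x = f y" for x y
    using that fh by (auto simp: M_def)
  interpret Y: Metric_space "mspace Y" "mdist Y" by simp
  interpret M: Metric_space M d
  proof
    show "d x y = 0 \<longleftrightarrow> x = y" if "x \<in> M" "y \<in> M" for x y
      using that inM inj by (auto simp: d_def)
    show "d x z \<le> d x y + d y z" if "x \<in> M" "y \<in> M" "z \<in> M" for x y z
      using that inM by (auto simp: d_def intro: Y.triangle)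
  qed (auto simp: d_def Y.commute)
  define Y' where "Y' = metric (M, d)"
  have Y': "mspace Y' = M" "mdist Y' = d"
    by (simp_all add: Y'_def M.mspace_metric M.mdist_metric)
  show thesis
  proof
    show "Lipschitz_continuous_map (submetric X E) Y' (h \<circ> f)"
      using f E fh by (auto simp: Lipschitz_continuous_map_def Y' d_def M_def Pi_iff)
    show "bij_betw h (f ` E) ((h \<circ> f) ` E)"
      unfolding bij_betw_def image_comp using fh by (metis inj_on_inverseI)
    show "mdist Y' (h x) (h y) = mdist Y x y" if "x \<in> f ` E" "y \<in> f ` E" for x y
      using that fh by (simp add: Y' d_def)
  qed
qed


section \<open>Hausdorff dimension\<close>

definition mdiam :: "'a metric \<Rightarrow> 'a set \<Rightarrow> ennreal" where
  "mdiam X U = (SUP x\<in>U. SUP y\<in>U. ennreal (mdist X x y))"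

text \<open>
  The \<open>s\<close>-th power of the diameter of a bounded set, with the usual conventions for \<open>s = 0\<close>: the
  empty set contributes \<open>0\<close> and any nonempty set contributes \<open>1\<close> (whereas \<open>0 powr 0 = 0\<close> in HOL).
\<close>

definition diam_pow :: "'a metric \<Rightarrow> real \<Rightarrow> 'a set \<Rightarrow> ennreal" where
  "diam_pow X s U =
     (if U = {} then 0 else if s = 0 then 1 else ennreal (enn2real (mdiam X U) powr s))"

definition Hausdorff_premeasure :: "'a metric \<Rightarrow> real \<Rightarrow> real \<Rightarrow> 'a set \<Rightarrow> ennreal" where
  "Hausdorff_premeasure X s \<delta> A =
     (INF U \<in> {U :: nat \<Rightarrow> 'a set. A \<subseteq> (\<Union>i. U i) \<and>
                 (\<forall>i. U i \<subseteq> mspace X \<and> mdiam X (U i) \<le> ennreal \<delta>)}.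
        \<Sum>i. diam_pow X s (U i))"

definition Hausdorff_measure :: "'a metric \<Rightarrow> real \<Rightarrow> 'a set \<Rightarrow> ennreal" where
  "Hausdorff_measure X s A = (SUP \<delta>\<in>{0<..}. Hausdorff_premeasure X s \<delta> A)"

definition HD :: "'a metric \<Rightarrow> ennreal" where
  "HD X = (INF s \<in> {s. 0 \<le> s \<and> Hausdorff_measure X s (mspace X) = 0}. ennreal s)"

end

theory Submission
  imports Defs
begin

text \<open>
  Lipschitz maps do not raise Hausdorff dimension, and \<open>D\<close> is at most \<open>Ind\<close> when the latter is
  finite (take a single piece, indexed by \<open>0\<close>). So it suffices to show that a space of zero
  \<open>(n + 1)\<close>-dimensional Hausdorff measure has \<open>Ind \<le> n\<close>. This goes by induction on \<open>n\<close>: a closed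
  set and an open neighbourhood are separated by the level sets of a continuous function that is
  Lipschitz on each of countably many pieces covering the space, and by Eilenberg's inequality
  almost every level set has zero \<open>n\<close>-dimensional measure. For null sets the bound \<open>\<delta>\<close> on the
  diameters of the covering sets plays no role, so the argument uses a fixed \<open>\<delta>\<close> throughout.
\<close>

section \<open>Finite ordinals\<close>

text \<open>A greatest element has no successor, and the \<open>LEAST\<close> in
  \<open>osucc\<close> then has an unspecified value. The assumption of some larger element excludes
  this here and in \<open>osucc_le\<close>.\<close>

lemma less_osucc:
  fixes \<alpha> :: "'b::wellorder"
  assumes "\<alpha> < \<gamma>" shows "\<alpha> < osucc \<alpha>"
  unfolding osucc_def using assms by (rule LeastI)

lemma osucc_le:
  fixes \<alpha> :: "'b::wellorder"
  assumes "\<alpha> < \<gamma>" shows "osucc \<alpha> \<le> \<gamma>"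
  unfolding osucc_def using assms by (rule Least_le)

lemma lessThan_osucc:
  fixes \<alpha> :: "'b::wellorder"
  shows "{..<osucc \<alpha>} \<subseteq> {..\<alpha>}"
  unfolding osucc_def using not_less_Least linorder_not_less by auto

text \<open>The empty relation is the cardinal order of the empty set, and that embeds into every
  well-order.\<close>

lemma zero_ordertype_le: "0 \<le> (\<alpha> :: 'b ordertype)"
proof transfer
  fix r :: "'b rel" assume "(r, r) \<in> ordIso"
  then have r: "Well_order r" by (simp add: ordIso_def)
  have "card_of ({} :: 'b set) = {}"
    using card_of_Well_order[of "{} :: 'b set"] Field_card_of[of "{} :: 'b set"]
    by (auto simp: Field_def)
  moreover have "(card_of ({} :: 'b set), r) \<in> ordLeq"
    using r by (intro card_of_empty1) simp
  ultimately show "({} :: 'b rel, r) \<in> ordLeq" by simp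
qed

section \<open>Infinite initial segments and limit ordinals\<close>

lift_definition cardinal_ordertype :: "'b set \<Rightarrow> 'b ordertype" is card_of
  by (rule card_of_refl)

lemma cardinal_ordertype_mono: "A \<subseteq> B \<Longrightarrow> cardinal_ordertype A \<le> cardinal_ordertype B"
  by transfer (rule card_of_mono1)

lemma cardinal_ordertype_eq:
  assumes "cardinal_ordertype A = cardinal_ordertype B" shows "card A = card B"
proof -
  have "(card_of A, card_of B) \<in> ordIso" using assms by transfer
  then show ?thesis by (metis card_of_ordIso bij_betw_same_card)
qed

lemma infinite_initial_segment:
  assumes "infinite (UNIV :: 'b set)"
  shows "\<exists>\<alpha> :: 'b ordertype. infinite {..<\<alpha>}"
proof -
  obtain e :: "nat \<Rightarrow> 'b" where e: "inj e"
    using assms infinite_countable_subset by blast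
  define c where "c = (\<lambda>n. cardinal_ordertype (e ` {..<n}))"
  have card: "card (e ` {..<n}) = n" for n
    using e by (simp add: card_image inj_on_subset)
  have inj: "inj c"
    by (rule injI) (metis c_def card cardinal_ordertype_eq)
  have "c n < cardinal_ordertype UNIV" for n
  proof -
    have "c n \<le> c (Suc n)" "c (Suc n) \<le> cardinal_ordertype UNIV"
      by (auto simp: c_def intro!: cardinal_ordertype_mono)
    moreover have "c n \<noteq> c (Suc n)" using inj by (auto dest: injD)
    ultimately show ?thesis by order
  qed
  then have "range c \<subseteq> {..<cardinal_ordertype UNIV}" by auto
  then show ?thesis using inj finite_subset range_inj_infinite by blast
qed

lemma infinite_lessThan_ord: "\<exists>\<alpha> :: 'a ord. infinite {..<\<alpha>}"
  by (rule infinite_initial_segment) (simp add: Finite_Set.finite_set)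

lemma finite_lessThan_ord_of_nat: "finite {..<ord_of_nat n :: 'a ord}"
proof (induction n)
  case 0
  have "{..<0 :: 'a ord} = {}" using zero_ordertype_le leD by auto
  then show ?case by (simp add: ord_of_nat_def)
next
  case (Suc n)
  have "{..ord_of_nat n :: 'a ord} = insert (ord_of_nat n) {..<ord_of_nat n}" by auto
  then have "finite {..ord_of_nat n :: 'a ord}" using Suc by simp
  then show ?case
    using lessThan_osucc[of "ord_of_nat n :: 'a ord"] finite_subset
    by (auto simp: ord_of_nat_def)
qed

text \<open>An infinite initial segment cannot fit into the finite one below
  \<open>ord_of_nat n\<close>, so something lies above \<open>ord_of_nat n\<close> and its successor
  is genuine.\<close>

lemma ord_of_nat_less_Suc: "ord_of_nat n < (ord_of_nat (Suc n) :: 'a ord)"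
proof -
  obtain \<alpha> :: "'a ord" where "infinite {..<\<alpha>}" using infinite_lessThan_ord by blast
  then have "\<not> {..<\<alpha>} \<subseteq> {..<ord_of_nat n}"
    using finite_lessThan_ord_of_nat finite_subset by blast
  then have "ord_of_nat n < \<alpha>" by (simp add: not_le)
  then show ?thesis by (auto simp: ord_of_nat_def dest: less_osucc)
qed

lemma strict_mono_ord_of_nat: "strict_mono (ord_of_nat :: nat \<Rightarrow> 'a ord)"
  by (rule strict_monoI_Suc) (rule ord_of_nat_less_Suc)

text \<open>A limit ordinal is closed under successors; 0 is not a limit under
  \<open>limit_ordinal\<close>, which starts the induction.\<close>

lemma ord_of_nat_less_limit:
  assumes "limit_ordinal (\<gamma> :: 'a ord)" shows "ord_of_nat n < \<gamma>"
proof (induction n)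
  case 0
  obtain \<beta> where "\<beta> < \<gamma>" using assms by (auto simp: limit_ordinal_def)
  then show ?case using zero_ordertype_le[of \<beta>] by (simp add: ord_of_nat_def)
next
  case (Suc n)
  then obtain \<beta> where "ord_of_nat n < \<beta>" "\<beta> < \<gamma>"
    using assms by (auto simp: limit_ordinal_def)
  then show ?case using osucc_le[of "ord_of_nat n" \<beta>] by (auto simp: ord_of_nat_def)
qed

text \<open>The least \<gamma> with infinitely many predecessors is a limit, since a successor of an
  ordinal with finitely many predecessors again has finitely many. This gives the
  \<open>LEAST\<close> in \<open>omega0\<close> its meaning.\<close>

lemma limit_ordinal_ex: "\<exists>\<gamma> :: 'a ord. limit_ordinal \<gamma>"
proof -
  obtain \<gamma> :: "'a ord" where inf: "infinite {..<\<gamma>}"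
    and least: "\<And>\<beta>. \<beta> < \<gamma> \<Longrightarrow> finite {..<\<beta>}"
    using infinite_lessThan_ord exists_least_iff[of "\<lambda>\<alpha> :: 'a ord. infinite {..<\<alpha>}"] by blast
  have "\<exists>\<delta>. \<beta> < \<delta> \<and> \<delta> < \<gamma>" if "\<beta> < \<gamma>" for \<beta>
  proof (intro exI conjI)
    show "\<beta> < osucc \<beta>" using that by (rule less_osucc)
    have "{..\<beta>} = insert \<beta> {..<\<beta>}" by auto
    then have "finite {..<osucc \<beta>}"
      using least[OF that] lessThan_osucc finite_subset by (metis finite_insert)
    then have "osucc \<beta> \<noteq> \<gamma>" using inf by auto
    then show "osucc \<beta> < \<gamma>" using osucc_le[OF that] by simp
  qed
  moreover have "\<exists>\<beta>. \<beta> < \<gamma>" using inf by (metis finite.emptyI lessThan_iff ex_in_conv)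
  ultimately show ?thesis by (auto simp: limit_ordinal_def)
qed

lemma ord_of_nat_less_omega0: "ord_of_nat n < (omega0 :: 'a ord)"
  unfolding omega0_def by (rule ord_of_nat_less_limit) (rule LeastI_ex[OF limit_ordinal_ex])

text \<open>Every limit ordinal lies above \<open>ord_of_nat n\<close>, so the default 0
  applies.\<close>

lemma limit_part_ord_of_nat: "limit_part (ord_of_nat n :: 'a ord) = 0"
  using ord_of_nat_less_limit leD by (auto simp: limit_part_def)

lemma finite_part_ord_of_nat: "finite_part (ord_of_nat n :: 'a ord) = n"
proof -
  have "(osucc ^^ k) 0 = (ord_of_nat k :: 'a ord)" for k by (simp add: ord_of_nat_def)
  then show ?thesis
    unfolding finite_part_def limit_part_ord_of_nat
    using strict_mono_eq[OF strict_mono_ord_of_nat[where 'a='a]] by (auto intro!: the_equality)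
qed


section \<open>Null sets of the Hausdorff premeasure\<close>

lemma mdist_le_mdiam: "x \<in> U \<Longrightarrow> y \<in> U \<Longrightarrow> ennreal (mdist X x y) \<le> mdiam X U"
  unfolding mdiam_def by (rule SUP_upper2, assumption) (rule SUP_upper)

lemma mdist_le_enn2real_mdiam:
  assumes "x \<in> U" "y \<in> U" "mdiam X U < \<infinity>"
  shows "mdist X x y \<le> enn2real (mdiam X U)"
  using mdist_le_mdiam[OF assms(1,2)] assms(3)
  by (metis enn2real_ennreal enn2real_mono infinity_ennreal_def mdist_nonneg)

lemma mdiam_mono: "U \<subseteq> V \<Longrightarrow> mdiam X U \<le> mdiam X V"
  unfolding mdiam_def by (intro SUP_subset_mono) auto

lemma mdiam_submetric [simp]: "mdiam (submetric X S) U = mdiam X U"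
  by (simp add: mdiam_def)

lemma diam_pow_submetric [simp]: "diam_pow (submetric X S) s U = diam_pow X s U"
  by (simp add: diam_pow_def)

text \<open>\<open>enn2real\<close> sends infinity to 0, so monotonicity would fail if the larger
  set had infinite diameter.\<close>

lemma diam_pow_mono:
  assumes "U \<subseteq> V" "mdiam X V < \<infinity>" "0 \<le> s"
  shows "diam_pow X s U \<le> diam_pow X s V"
  using assms mdiam_mono[OF assms(1)]
  by (auto simp: diam_pow_def intro!: ennreal_leI powr_mono2 enn2real_mono)

text \<open>Powers of a number in [0, 1] decrease in the exponent. This is why the diameter bound 1
  appears wherever exponents are compared.\<close>

lemma diam_pow_antimono_exponent:
  assumes "mdiam X U \<le> 1" "0 \<le> s" "s \<le> t"
  shows "diam_pow X t U \<le> diam_pow X s U"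
proof -
  have "enn2real (mdiam X U) \<le> 1"
    using assms(1) by (intro enn2real_leI) auto
  then show ?thesis
    using assms(2,3) powr_mono'[of s t] powr_le1[of t]
    by (auto simp: diam_pow_def intro!: ennreal_leI)
qed

lemma diam_pow_Suc:
  "diam_pow X (real (Suc p)) U = diam_pow X (real p) U * ennreal (enn2real (mdiam X U))"
  by (auto simp: diam_pow_def powr_add ennreal_mult[symmetric])

section \<open>Null sets under restriction, unions and Lipschitz maps\<close>

lemma premeasure_zeroD:
  assumes "Hausdorff_premeasure X s \<delta> A = 0" "0 < \<epsilon>"
  obtains U :: "nat \<Rightarrow> 'a set" where "A \<subseteq> (\<Union>i. U i)" "\<And>i. U i \<subseteq> mspace X"
    "\<And>i. mdiam X (U i) \<le> ennreal \<delta>" "(\<Sum>i. diam_pow X s (U i)) < \<epsilon>"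
proof -
  have "Hausdorff_premeasure X s \<delta> A < \<epsilon>" using assms by simp
  then show thesis unfolding Hausdorff_premeasure_def INF_less_iff using that by blast
qed

lemma premeasure_le:
  assumes "A \<subseteq> (\<Union>i. U i)" "\<And>i. U i \<subseteq> mspace X" "\<And>i. mdiam X (U i) \<le> ennreal \<delta>"
  shows "Hausdorff_premeasure X s \<delta> A \<le> (\<Sum>i. diam_pow X s (U i))"
  unfolding Hausdorff_premeasure_def using assms by (intro INF_lower) auto

lemma premeasure_mono:
  "A \<subseteq> B \<Longrightarrow> Hausdorff_premeasure X s \<delta> A \<le> Hausdorff_premeasure X s \<delta> B"
  unfolding Hausdorff_premeasure_def by (intro INF_superset_mono) auto

text \<open>Intersecting the covering sets with \<open>S\<close> makes them admissible in the
  subspace and does not increase their diameters.\<close>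

lemma premeasure_submetric:
  assumes "Hausdorff_premeasure X s \<delta> S = 0" "S \<subseteq> mspace X" "0 \<le> s"
  shows "Hausdorff_premeasure (submetric X S) s \<delta> S = 0"
proof (rule ccontr)
  assume "\<not> ?thesis"
  then have "0 < Hausdorff_premeasure (submetric X S) s \<delta> S" by (simp add: zero_less_iff_neq_zero)
  with assms(1) obtain U where U: "S \<subseteq> (\<Union>i. U i)" "\<And>i. U i \<subseteq> mspace X"
    "\<And>i. mdiam X (U i) \<le> ennreal \<delta>"
    "(\<Sum>i. diam_pow X s (U i)) < Hausdorff_premeasure (submetric X S) s \<delta> S"
    by (rule premeasure_zeroD) blast
  have "Hausdorff_premeasure (submetric X S) s \<delta> S \<le> (\<Sum>i. diam_pow (submetric X S) s (U i \<inter> S))"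
    using U assms(2) by (intro premeasure_le) (auto intro: order_trans[OF mdiam_mono])
  also have "\<dots> \<le> (\<Sum>i. diam_pow X s (U i))"
    using assms(3) le_less_trans[OF U(3) ennreal_less_top]
    by (intro suminf_le) (auto intro!: diam_pow_mono)
  finally show False using U(4) by simp
qed

lemma premeasure_antimono_exponent:
  assumes "0 \<le> s" "s \<le> t"
  shows "Hausdorff_premeasure X t 1 A \<le> Hausdorff_premeasure X s 1 A"
  unfolding Hausdorff_premeasure_def using assms
  by (intro INF_superset_mono suminf_le order_refl diam_pow_antimono_exponent) auto

text \<open>Cover the k-th set with total below \<epsilon> / 2^(k+1) and enumerate all the covers
  together through \<open>prod_decode\<close>. The diameter bound is unchanged.\<close>

lemma premeasure_UN:
  assumes "\<And>k. Hausdorff_premeasure X s \<delta> (A k) = 0"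
  shows "Hausdorff_premeasure X s \<delta> (\<Union>k::nat. A k) = 0"
proof -
  have "Hausdorff_premeasure X s \<delta> (\<Union>k. A k) \<le> 0 + ennreal \<epsilon>" if "0 < \<epsilon>" for \<epsilon>
  proof -
    have "\<forall>k. \<exists>U :: nat \<Rightarrow> 'a set. A k \<subseteq> (\<Union>i. U i) \<and> (\<forall>i. U i \<subseteq> mspace X) \<and>
        (\<forall>i. mdiam X (U i) \<le> ennreal \<delta>) \<and>
        (\<Sum>i. diam_pow X s (U i)) < ennreal (\<epsilon> * (1/2) ^ Suc k)"
    proof
      fix k
      have "0 < ennreal (\<epsilon> * (1/2) ^ Suc k)" using that by simp
      with assms[of k] show "\<exists>U :: nat \<Rightarrow> 'a set. A k \<subseteq> (\<Union>i. U i) \<and> (\<forall>i. U i \<subseteq> mspace X) \<and>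
        (\<forall>i. mdiam X (U i) \<le> ennreal \<delta>) \<and>
        (\<Sum>i. diam_pow X s (U i)) < ennreal (\<epsilon> * (1/2) ^ Suc k)"
        by (rule premeasure_zeroD) blast
    qed
    then obtain U :: "nat \<Rightarrow> nat \<Rightarrow> 'a set" where U: "\<And>k. A k \<subseteq> (\<Union>i. U k i)"
      "\<And>k i. U k i \<subseteq> mspace X" "\<And>k i. mdiam X (U k i) \<le> ennreal \<delta>"
      "\<And>k. (\<Sum>i. diam_pow X s (U k i)) < ennreal (\<epsilon> * (1/2) ^ Suc k)"
      by metis
    define W where "W = (\<lambda>(k, i). U k i)"
    have "(\<Union>k. A k) \<subseteq> (\<Union>n. W (prod_decode n))"
    proof
      fix x assume "x \<in> (\<Union>k. A k)"
      then obtain k i where "x \<in> U k i" using U(1) by blast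
      then have "x \<in> W (prod_decode (prod_encode (k, i)))" by (simp add: W_def)
      then show "x \<in> (\<Union>n. W (prod_decode n))" by blast
    qed
    then have "Hausdorff_premeasure X s \<delta> (\<Union>k. A k) \<le> (\<Sum>n. diam_pow X s (W (prod_decode n)))"
      using U(2,3) by (intro premeasure_le) (auto simp: W_def split: prod.splits)
    also have "\<dots> = (\<Sum>k i. diam_pow X s (U k i))"
      by (rule suminf_ennreal_2dimen[where f = "\<lambda>n. diam_pow X s (W n)"]) (simp add: W_def)
    also have "\<dots> \<le> (\<Sum>k. ennreal (\<epsilon> * (1/2) ^ Suc k))"
      using U(4) by (intro suminf_le) (auto intro: less_imp_le)
    also have "\<dots> = ennreal \<epsilon>"
      using sums_mult[OF power_half_series, of \<epsilon>] that
      by (intro suminf_ennreal_eq) auto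
    finally show ?thesis by simp
  qed
  then have "Hausdorff_premeasure X s \<delta> (\<Union>k. A k) \<le> 0"
    by (rule ennreal_le_epsilon)
  then show ?thesis by simp
qed

lemma premeasure_Lipschitz_image:
  assumes null: "Hausdorff_premeasure X s \<delta> E = 0" and "0 \<le> s" "0 < B"
    and E: "E \<subseteq> mspace X" and f: "f ` E \<subseteq> mspace Y"
    and Lip: "\<And>x y. x \<in> E \<Longrightarrow> y \<in> E \<Longrightarrow> mdist Y (f x) (f y) \<le> B * mdist X x y"
  shows "Hausdorff_premeasure Y s (B * \<delta>) (f ` E) = 0"
proof -
  have "Hausdorff_premeasure Y s (B * \<delta>) (f ` E) \<le> 0 + ennreal \<epsilon>" if "0 < \<epsilon>" for \<epsilon>
  proof -
    \<comment> \<open>Diameters grow by at most the factor \<open>B\<close>, hence their powers by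
      \<open>B powr s\<close>; dividing by it in advance leaves the total \<epsilon>.\<close>
    have "0 < ennreal (\<epsilon> / B powr s)" using that \<open>0 < B\<close> by simp
    with null obtain U where U: "E \<subseteq> (\<Union>i. U i)" "\<And>i. U i \<subseteq> mspace X"
      "\<And>i. mdiam X (U i) \<le> ennreal \<delta>" "(\<Sum>i. diam_pow X s (U i)) < ennreal (\<epsilon> / B powr s)"
      by (rule premeasure_zeroD) blast
    define V where "V = (\<lambda>i. f ` (U i \<inter> E))"
    have diam: "mdiam Y (V i) \<le> ennreal B * mdiam X (U i)" for i
      unfolding mdiam_def[of Y] V_def
    proof (intro SUP_least)
      fix x y assume "x \<in> f ` (U i \<inter> E)" "y \<in> f ` (U i \<inter> E)"
      then obtain a b where ab: "a \<in> U i" "b \<in> U i" "a \<in> E" "b \<in> E" "x = f a" "y = f b" by auto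
      have "ennreal (mdist Y x y) \<le> ennreal B * ennreal (mdist X a b)"
        using Lip ab \<open>0 < B\<close> by (simp add: ennreal_mult[symmetric] ennreal_leI)
      also have "\<dots> \<le> ennreal B * mdiam X (U i)"
        using ab by (intro mult_left_mono mdist_le_mdiam) auto
      finally show "ennreal (mdist Y x y) \<le> ennreal B * mdiam X (U i)" .
    qed
    have pow: "diam_pow Y s (V i) \<le> ennreal (B powr s) * diam_pow X s (U i)" for i
    proof -
      have fin: "mdiam X (U i) < top" by (rule le_less_trans[OF U(3) ennreal_less_top])
      then have "ennreal B * mdiam X (U i) < top" by (simp add: ennreal_mult_less_top)
      then have "enn2real (mdiam Y (V i)) \<le> B * enn2real (mdiam X (U i))"
        using enn2real_mono[OF diam] \<open>0 < B\<close> by (simp add: enn2real_mult)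
      then have "enn2real (mdiam Y (V i)) powr s \<le> B powr s * enn2real (mdiam X (U i)) powr s"
        using \<open>0 \<le> s\<close> \<open>0 < B\<close> powr_mono2[of s] by (simp add: powr_mult[symmetric])
      then show ?thesis using \<open>0 < B\<close>
        by (auto simp: diam_pow_def V_def ennreal_mult[symmetric] ennreal_leI)
    qed
    have "Hausdorff_premeasure Y s (B * \<delta>) (f ` E) \<le> (\<Sum>i. diam_pow Y s (V i))"
    proof (rule premeasure_le)
      show "f ` E \<subseteq> (\<Union>i. V i)" unfolding V_def using U(1) by blast
      show "V i \<subseteq> mspace Y" for i using f by (auto simp: V_def)
      show "mdiam Y (V i) \<le> ennreal (B * \<delta>)" for i
        using order_trans[OF diam mult_left_mono[OF U(3)]] \<open>0 < B\<close> by (simp add: ennreal_mult')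
    qed
    also have "\<dots> \<le> (\<Sum>i. ennreal (B powr s) * diam_pow X s (U i))"
      using pow by (intro suminf_le) auto
    also have "\<dots> \<le> ennreal (B powr s) * ennreal (\<epsilon> / B powr s)"
      using U(4) by (auto intro!: mult_left_mono intro: less_imp_le)
    also have "\<dots> = ennreal \<epsilon>"
      using that \<open>0 < B\<close> by (simp add: ennreal_mult[symmetric])
    finally show ?thesis by simp
  qed
  then have "Hausdorff_premeasure Y s (B * \<delta>) (f ` E) \<le> 0"
    by (rule ennreal_le_epsilon)
  then show ?thesis by simp
qed

section \<open>Level sets of Lipschitz functions\<close>

lemma suminf_const_ennreal:
  assumes "0 < (c :: ennreal)" shows "(\<Sum>i::nat. c) = top"
proof -
  have "(\<Sum>i::nat. c) = (\<integral>\<^sup>+i. c \<partial>count_space (UNIV :: nat set))"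
    by (rule nn_integral_count_space_nat[symmetric])
  also have "\<dots> = top"
    using assms by (simp add: ennreal_mult_top)
  finally show ?thesis .
qed

text \<open>An Eilenberg type estimate: a set of diameter d meets the level set at r only for r in
  an interval of length 2Ld. Integrating the p-th powers over these intervals trades one factor d
  for the length, so the integral is at most 2L times a sum of (p+1)-st powers, which can be made
  small.\<close>

lemma AE_premeasure_slice:
  assumes null: "Hausdorff_premeasure X (real (Suc p)) \<delta> A = 0" and "0 \<le> L"
    and Lip: "\<And>x y. x \<in> A \<Longrightarrow> y \<in> A \<Longrightarrow> \<bar>g x - g y\<bar> \<le> L * mdist X x y"
  shows "AE r in lborel. Hausdorff_premeasure X (real p) \<delta> {x \<in> A. g x = r} = 0"
proof -
  have "\<forall>k. \<exists>U :: nat \<Rightarrow> 'a set. A \<subseteq> (\<Union>i. U i) \<and> (\<forall>i. U i \<subseteq> mspace X) \<and>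
        (\<forall>i. mdiam X (U i) \<le> ennreal \<delta>) \<and>
        (\<Sum>i. diam_pow X (real (Suc p)) (U i)) < ennreal ((1/2) ^ Suc k)"
  proof
    fix k
    have "0 < ennreal ((1/2) ^ Suc k)" by simp
    with null show "\<exists>U :: nat \<Rightarrow> 'a set. A \<subseteq> (\<Union>i. U i) \<and> (\<forall>i. U i \<subseteq> mspace X) \<and>
        (\<forall>i. mdiam X (U i) \<le> ennreal \<delta>) \<and>
        (\<Sum>i. diam_pow X (real (Suc p)) (U i)) < ennreal ((1/2) ^ Suc k)"
      by (rule premeasure_zeroD) blast
  qed
  then obtain U :: "nat \<Rightarrow> nat \<Rightarrow> 'a set" where U: "\<And>k. A \<subseteq> (\<Union>i. U k i)"
    "\<And>k i. U k i \<subseteq> mspace X" "\<And>k i. mdiam X (U k i) \<le> ennreal \<delta>"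
    "\<And>k. (\<Sum>i. diam_pow X (real (Suc p)) (U k i)) < ennreal ((1/2) ^ Suc k)"
    by metis
  define V where "V = (\<lambda>k i. U k i \<inter> A)"
  define d where "d = (\<lambda>k i. enn2real (mdiam X (V k i)))"
  \<comment> \<open>For empty \<open>V k i\<close> the choice is arbitrary, but the corresponding
    term of \<open>f\<close> is 0.\<close>
  define x where "x = (\<lambda>k i. SOME z. z \<in> V k i)"
  define J where "J = (\<lambda>k i. {g (x k i) - L * d k i .. g (x k i) + L * d k i})"
  \<comment> \<open>A measurable majorant of the premeasure of the slice at r, so that measurability
    in r of the premeasure itself never has to be shown.\<close>
  define f where "f = (\<lambda>k r. \<Sum>i. diam_pow X (real p) (V k i) * indicator (J k i) r)"
  have V: "V k i \<subseteq> mspace X" "V k i \<subseteq> A" for k i using U(2) by (auto simp: V_def)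
  have diam: "mdiam X (V k i) \<le> ennreal \<delta>" for k i
    by (rule order_trans[OF mdiam_mono U(3)]) (auto simp: V_def)
  have diam_top: "mdiam X (V k i) < top" for k i
    by (rule le_less_trans[OF diam ennreal_less_top])
  have meas: "f k \<in> borel_measurable lborel" for k
    unfolding f_def J_def by measurable
  have integral: "(\<integral>\<^sup>+r. f k r \<partial>lborel) \<le> ennreal (2 * L * (1/2) ^ Suc k)" for k
  proof -
    have "(\<integral>\<^sup>+r. f k r \<partial>lborel) = (\<Sum>i. \<integral>\<^sup>+r. diam_pow X (real p) (V k i) * indicator (J k i) r \<partial>lborel)"
      unfolding f_def by (rule nn_integral_suminf) (simp add: J_def)
    also have "\<dots> = (\<Sum>i. diam_pow X (real p) (V k i) * ennreal (2 * L * d k i))"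
    proof -
      have "0 \<le> L * d k i" for i using \<open>0 \<le> L\<close> by (simp add: d_def)
      then have "emeasure lborel (J k i) = ennreal (2 * L * d k i)" for i
        unfolding J_def by (subst emeasure_lborel_Icc) (auto intro: arg_cong[where f = ennreal])
      moreover have "J k i \<in> sets lborel" for i by (simp add: J_def)
      ultimately show ?thesis by (simp only: nn_integral_cmult_indicator)
    qed
    also have "\<dots> = (\<Sum>i. ennreal (2 * L) * diam_pow X (real (Suc p)) (V k i))"
    proof -
      have "ennreal (2 * L * d k i) = ennreal (2 * L) * ennreal (d k i)" for i
        using \<open>0 \<le> L\<close> by (intro ennreal_mult) (auto simp: d_def)
      then show ?thesis unfolding diam_pow_Suc by (simp only: d_def ac_simps)
    qed
    also have "\<dots> \<le> (\<Sum>i. ennreal (2 * L) * diam_pow X (real (Suc p)) (U k i))"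
      using le_less_trans[OF U(3) ennreal_less_top]
      by (intro suminf_le mult_left_mono diam_pow_mono) (auto simp: V_def)
    also have "\<dots> \<le> ennreal (2 * L) * ennreal ((1/2) ^ Suc k)"
      unfolding ennreal_suminf_cmult using U(4)[of k] by (intro mult_left_mono) auto
    also have "\<dots> = ennreal (2 * L * (1/2) ^ Suc k)"
      using \<open>0 \<le> L\<close> by (intro ennreal_mult[symmetric]) auto
    finally show ?thesis .
  qed
  have "(\<integral>\<^sup>+r. (\<Sum>k. f k r) \<partial>lborel) = (\<Sum>k. \<integral>\<^sup>+r. f k r \<partial>lborel)"
    by (rule nn_integral_suminf[OF meas])
  also have "\<dots> \<le> (\<Sum>k. ennreal (2 * L * (1/2) ^ Suc k))"
    using integral by (intro suminf_le) auto
  also have "\<dots> = ennreal (2 * L)"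
    using sums_mult[OF power_half_series, of "2 * L"] \<open>0 \<le> L\<close>
    by (intro suminf_ennreal_eq) auto
  finally have "(\<integral>\<^sup>+r. (\<Sum>k. f k r) \<partial>lborel) \<noteq> \<infinity>"
    by (auto simp: top_unique)
  \<comment> \<open>The integrals of the \<open>f k\<close> are summable, so their sum is finite
    almost everywhere.\<close>
  then have "AE r in lborel. (\<Sum>k. f k r) \<noteq> \<infinity>"
    using meas by (intro nn_integral_PInf_AE borel_measurable_suminf) auto
  then show ?thesis
  proof eventually_elim
    fix r assume fin: "(\<Sum>k. f k r) \<noteq> \<infinity>"
    have le: "Hausdorff_premeasure X (real p) \<delta> {x \<in> A. g x = r} \<le> f k r" for k
    proof -
      define W where "W = (\<lambda>i. {z \<in> V k i. g z = r})"
      have "Hausdorff_premeasure X (real p) \<delta> {x \<in> A. g x = r} \<le> (\<Sum>i. diam_pow X (real p) (W i))"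
      proof (rule premeasure_le)
        show "{x \<in> A. g x = r} \<subseteq> (\<Union>i. W i)" using U(1)[of k] by (auto simp: W_def V_def)
        show "W i \<subseteq> mspace X" for i using V(1) by (auto simp: W_def)
        show "mdiam X (W i) \<le> ennreal \<delta>" for i
          by (rule order_trans[OF mdiam_mono diam[of k i]]) (auto simp: W_def)
      qed
      also have "\<dots> \<le> f k r"
        unfolding f_def
      proof (intro suminf_le)
        fix i
        show "diam_pow X (real p) (W i) \<le> diam_pow X (real p) (V k i) * indicator (J k i) r"
        proof (cases "W i = {}")
          case True
          then show ?thesis by (simp add: diam_pow_def)
        next
          case False
          then obtain y where y: "y \<in> V k i" "g y = r" by (auto simp: W_def)
          have x: "x k i \<in> V k i" unfolding x_def using y(1) by (rule someI)
          have "\<bar>g y - g (x k i)\<bar> \<le> L * mdist X y (x k i)"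
            using x y V(2) by (intro Lip) auto
          also have "\<dots> \<le> L * d k i"
            unfolding d_def using x y diam_top \<open>0 \<le> L\<close>
            by (intro mult_left_mono mdist_le_enn2real_mdiam) auto
          finally have "r \<in> J k i" using y(2) by (auto simp: J_def)
          moreover have "diam_pow X (real p) (W i) \<le> diam_pow X (real p) (V k i)"
            using diam_top by (intro diam_pow_mono) (auto simp: W_def)
          ultimately show ?thesis by simp
        qed
      qed auto
      finally show ?thesis .
    qed
    show "Hausdorff_premeasure X (real p) \<delta> {x \<in> A. g x = r} = 0"
    \<comment> \<open>The premeasure of the slice is below every \<open>f k r\<close>. A positive
      constant summed over all k would be infinite, against \<open>fin\<close>.\<close>
    proof (rule ccontr)
      assume "\<not> ?thesis"
      then have "(\<Sum>k::nat. Hausdorff_premeasure X (real p) \<delta> {x \<in> A. g x = r}) = top"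
        by (intro suminf_const_ennreal) (simp add: zero_less_iff_neq_zero)
      moreover have "(\<Sum>k::nat. Hausdorff_premeasure X (real p) \<delta> {x \<in> A. g x = r}) \<le> (\<Sum>k. f k r)"
        by (intro suminf_le le) auto
      ultimately show False using fin by (simp add: top_unique)
    qed
  qed
qed


section \<open>Large inductive dimension\<close>

lemma distance_to_closed_set:
  assumes "closedin (mtopology_of X) F" "F \<noteq> {}"
  obtains f where "\<And>x. x \<in> mspace X \<Longrightarrow> 0 \<le> (f x :: real)"
    "\<And>x. x \<in> mspace X \<Longrightarrow> f x = 0 \<longleftrightarrow> x \<in> F"
    "\<And>x y. x \<in> mspace X \<Longrightarrow> y \<in> mspace X \<Longrightarrow> \<bar>f x - f y\<bar> \<le> mdist X x y"
proof
  define f where "f = (\<lambda>x. INF z\<in>F. mdist X x z)"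
  interpret X: Metric_space "mspace X" "mdist X" by simp
  have F: "F \<subseteq> mspace X" using closedin_subset[OF assms(1)] by simp
  have bdd: "bdd_below (mdist X x ` F)" for x by (rule bdd_belowI[of _ 0]) auto
  have lower: "f x \<le> mdist X x z" if "z \<in> F" for x z
    unfolding f_def using bdd that by (rule cINF_lower)
  have greatest: "c \<le> f x" if "\<And>z. z \<in> F \<Longrightarrow> c \<le> mdist X x z" for x c
    unfolding f_def using assms(2) that by (rule cINF_greatest)
  show "0 \<le> f x" for x by (rule greatest) simp
  show "f x = 0 \<longleftrightarrow> x \<in> F" if x: "x \<in> mspace X" for x
  proof
    assume "x \<in> F"
    then show "f x = 0" using lower[of x x] \<open>0 \<le> f x\<close> x by simp
  next
    assume 0: "f x = 0"
    show "x \<in> F"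
    proof (rule ccontr)
      assume "x \<notin> F"
      then obtain r where r: "0 < r" "disjnt F (X.mball x r)"
        using assms(1) x unfolding mtopology_of_def X.closedin_metric by auto
      \<comment> \<open>A ball about x that misses \<open>F\<close> keeps the distance to
        \<open>F\<close> at least its radius.\<close>
      have "r \<le> f x"
        using r F x by (intro greatest) (auto simp: disjnt_iff X.in_mball not_less[symmetric])
      then show False using 0 r(1) by simp
    qed
  qed
  have "f x \<le> mdist X x y + f y" if "x \<in> mspace X" "y \<in> mspace X" for x y
  proof -
    have "f x - mdist X x y \<le> f y"
    proof (rule greatest)
      fix z assume "z \<in> F"
      then show "f x - mdist X x y \<le> mdist X y z"
        using lower[of z x] X.triangle[of x y z] that F by force
    qed
    then show ?thesis by simp
  qed
  then show "\<bar>f x - f y\<bar> \<le> mdist X x y" if "x \<in> mspace X" "y \<in> mspace X" for x y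
    using that X.commute[of x y] by (fastforce simp: abs_le_iff)
qed

text \<open>The numerator of the difference is at most (a + b) d, so the factor a + b cancels and
  only a' + b' has to be bounded below by c.\<close>

lemma ratio_diff_le:
  fixes a b a' b' d :: real
  assumes "0 \<le> a" "0 \<le> b" "0 < a + b" "0 < c" "c \<le> a' + b'"
    and "\<bar>a - a'\<bar> \<le> d" "\<bar>b - b'\<bar> \<le> d"
  shows "\<bar>a / (a + b) - a' / (a' + b')\<bar> \<le> 1 / c * d"
proof -
  have pos: "0 < a' + b'" "0 \<le> d" using assms by auto
  have "a / (a + b) - a' / (a' + b') = (a * (b' - b) + b * (a - a')) / ((a + b) * (a' + b'))"
    using assms(3) pos by (simp add: field_simps)
  also have "\<bar>\<dots>\<bar> \<le> (a + b) * d / ((a + b) * (a' + b'))"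
  proof -
    have "\<bar>a * (b' - b) + b * (a - a')\<bar> \<le> a * \<bar>b' - b\<bar> + b * \<bar>a - a'\<bar>"
      using assms(1,2) by (metis abs_mult abs_of_nonneg abs_triangle_ineq)
    also have "\<dots> \<le> a * d + b * d"
      using assms by (intro add_mono mult_left_mono) (auto simp: abs_minus_commute)
    finally have "\<bar>a * (b' - b) + b * (a - a')\<bar> \<le> (a + b) * d" by (simp add: algebra_simps)
    moreover have "\<bar>(a + b) * (a' + b')\<bar> = (a + b) * (a' + b')" using assms(3) pos by simp
    ultimately show ?thesis
      unfolding abs_divide using assms(3) pos by (simp only: divide_right_mono mult_nonneg_nonneg less_imp_le)
  qed
  also have "\<dots> = d / (a' + b')" using assms(3) by simp
  also have "\<dots> \<le> d / c" using assms(4,5) pos by (intro divide_left_mono) auto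
  finally show ?thesis by simp
qed

lemma AE_lborel_ex_between:
  assumes "AE r in lborel. P r" "a < (b :: real)"
  shows "\<exists>r. a < r \<and> r < b \<and> P r"
proof (rule ccontr)
  assume "\<not> ?thesis"
  then have "AE r in lborel. r \<notin> {a<..<b}" using assms(1) by (auto elim!: eventually_mono)
  then have "{a<..<b} \<in> null_sets lborel" by (simp add: AE_iff_null_sets)
  then show False using assms(2) by (simp add: null_sets_def)
qed

text \<open>With a and b the distances to \<open>F\<close> and to the complement of
  \<open>V\<close>, the quotient a / (a + b) is 0 on \<open>F\<close> and 1 off \<open>V\<close>. A
  sublevel set at a suitable level between 0 and 1 separates, and its frontier lies in a null level
  set.\<close>

lemma null_frontier_separation:
  assumes null: "Hausdorff_premeasure X (real (Suc p)) \<delta> (mspace X) = 0"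
    and F: "closedin (mtopology_of X) F" and V: "openin (mtopology_of X) V" and "F \<subseteq> V"
  shows "\<exists>U. openin (mtopology_of X) U \<and> F \<subseteq> U \<and> U \<subseteq> V \<and>
    Hausdorff_premeasure X (real p) \<delta> (mtopology_of X frontier_of U) = 0"
proof -
  have empty: "Hausdorff_premeasure X (real p) \<delta> {} = 0"
    using premeasure_le[of "{}" "\<lambda>_. {}" X \<delta> "real p"] by (simp add: diam_pow_def mdiam_def bot_ennreal)
  have subset: "F \<subseteq> mspace X" "V \<subseteq> mspace X"
    using closedin_subset[OF F] openin_subset[OF V] by auto
  \<comment> \<open>Distance functions require nonempty sets; in the two degenerate cases the empty
    set and the whole space have empty frontier.\<close>
  consider "F = {}" | "V = mspace X" | "F \<noteq> {}" "mspace X - V \<noteq> {}" using subset by auto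
  then show ?thesis
  proof cases
    case 1
    then show ?thesis using empty by (intro exI[of _ "{}"]) simp
  next
    case 2
    have "mtopology_of X frontier_of mspace X = {}"
      using frontier_of_topspace[of "mtopology_of X"] by simp
    with 2 show ?thesis using empty V \<open>F \<subseteq> V\<close> by (intro exI[of _ "mspace X"]) auto
  next
    case 3
    have C: "closedin (mtopology_of X) (mspace X - V)" using V by (simp add: closedin_def subset double_diff)
    obtain a where a: "\<And>x. x \<in> mspace X \<Longrightarrow> 0 \<le> (a x :: real)"
      "\<And>x. x \<in> mspace X \<Longrightarrow> a x = 0 \<longleftrightarrow> x \<in> F"
      "\<And>x y. x \<in> mspace X \<Longrightarrow> y \<in> mspace X \<Longrightarrow> \<bar>a x - a y\<bar> \<le> mdist X x y"
      by (rule distance_to_closed_set[OF F 3(1)]) blast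
    obtain b where b: "\<And>x. x \<in> mspace X \<Longrightarrow> 0 \<le> (b x :: real)"
      "\<And>x. x \<in> mspace X \<Longrightarrow> b x = 0 \<longleftrightarrow> x \<in> mspace X - V"
      "\<And>x y. x \<in> mspace X \<Longrightarrow> y \<in> mspace X \<Longrightarrow> \<bar>b x - b y\<bar> \<le> mdist X x y"
      by (rule distance_to_closed_set[OF C 3(2)]) blast
    have pos: "0 < a x + b x" if "x \<in> mspace X" for x
    proof -
      have "a x \<noteq> 0 \<or> b x \<noteq> 0" using a(2) b(2) that \<open>F \<subseteq> V\<close> by blast
      then show ?thesis using a(1) b(1) that by (metis add_nonneg_eq_0_iff add_nonneg_nonneg less_le)
    qed
    define g where "g = (\<lambda>x. a x / (a x + b x))"
    \<comment> \<open>The quotient \<open>g\<close> need not be Lipschitz on the whole space, but it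
      is on each \<open>P k\<close>, where the denominator is at least 1 / (k+1). These sets cover
      the space because the denominator is positive.\<close>
    define P where "P = (\<lambda>k::nat. {x \<in> mspace X. inverse (real (Suc k)) \<le> a x + b x})"
    have "AE r in lborel. Hausdorff_premeasure X (real p) \<delta> {x \<in> P k. g x = r} = 0" for k
    proof (rule AE_premeasure_slice)
      have "Hausdorff_premeasure X (real (Suc p)) \<delta> (P k) \<le> 0"
        unfolding null[symmetric] by (rule premeasure_mono) (auto simp: P_def)
      then show "Hausdorff_premeasure X (real (Suc p)) \<delta> (P k) = 0" by simp
      show "0 \<le> 1 / inverse (real (Suc k))" by simp
      show "\<bar>g x - g y\<bar> \<le> 1 / inverse (real (Suc k)) * mdist X x y" if "x \<in> P k" "y \<in> P k" for x y
        unfolding g_def using that by (intro ratio_diff_le) (auto simp: P_def intro: a b pos)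
    qed
    then have "AE r in lborel. \<forall>k. Hausdorff_premeasure X (real p) \<delta> {x \<in> P k. g x = r} = 0"
      by (simp add: AE_all_countable)
    then obtain r where r: "0 < r" "r < 1"
      "\<And>k. Hausdorff_premeasure X (real p) \<delta> {x \<in> P k. g x = r} = 0"
      using AE_lborel_ex_between[OF _ zero_less_one] by blast
    have "{x \<in> mspace X. g x = r} = (\<Union>k. {x \<in> P k. g x = r})"
    proof -
      have "\<exists>k. x \<in> P k" if "x \<in> mspace X" for x
        using reals_Archimedean[OF pos[OF that]] that by (auto simp: P_def intro: less_imp_le)
      then show ?thesis by (auto simp: P_def)
    qed
    then have null_r: "Hausdorff_premeasure X (real p) \<delta> {x \<in> mspace X. g x = r} = 0"
      using premeasure_UN[OF r(3)] by simp
    \<comment> \<open>As a + b > 0, the sign of \<open>h\<close> is that of \<open>g\<close> - r.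
      Unlike \<open>g\<close>, \<open>h\<close> is 1-Lipschitz on the whole space, which gives
      continuity at once.\<close>
    define h where "h = (\<lambda>x. a x - r * (a x + b x))"
    have h_eq: "h x = (1 - r) * a x - r * b x" for x by (simp add: h_def algebra_simps)
    have "Lipschitz_continuous_map X euclidean_metric h"
      unfolding Lipschitz_continuous_map_def
    proof (intro conjI exI ballI)
      fix x y assume xy: "x \<in> mspace X" "y \<in> mspace X"
      have "\<bar>h x - h y\<bar> = \<bar>(1 - r) * (a x - a y) - r * (b x - b y)\<bar>"
        by (simp add: h_eq algebra_simps)
      also have "\<dots> \<le> (1 - r) * \<bar>a x - a y\<bar> + r * \<bar>b x - b y\<bar>"
        using r(1,2) by (metis abs_mult abs_of_pos abs_triangle_ineq4 diff_gt_0_iff_gt)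
      also have "\<dots> \<le> (1 - r) * mdist X x y + r * mdist X x y"
        using a(3)[OF xy] b(3)[OF xy] r(1,2) by (intro add_mono mult_left_mono) auto
      finally show "mdist euclidean_metric (h x) (h y) \<le> 1 * mdist X x y"
        by (simp add: dist_real_def algebra_simps)
    qed simp
    then have cont: "continuous_map (mtopology_of X) euclidean h"
      using Lipschitz_continuous_imp_continuous_map by fastforce
    define U where "U = {x \<in> mspace X. h x < 0}"
    have U: "openin (mtopology_of X) U"
      using openin_continuous_map_preimage[OF cont, of "{..<0}"] by (simp add: U_def)
    have "closedin (mtopology_of X) {x \<in> mspace X. h x \<le> 0}"
      using closedin_continuous_map_preimage[OF cont, of "{..0}"] by simp
    then have "mtopology_of X closure_of U \<subseteq> {x \<in> mspace X. h x \<le> 0}"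
      by (intro closure_of_minimal) (auto simp: U_def)
    then have "mtopology_of X frontier_of U \<subseteq> {x \<in> mspace X. h x = 0}"
      unfolding frontier_of_openin[OF U] by (auto simp: U_def)
    also have "\<dots> \<subseteq> {x \<in> mspace X. g x = r}"
      using pos by (fastforce simp: g_def h_def field_simps)
    finally have "Hausdorff_premeasure X (real p) \<delta> (mtopology_of X frontier_of U) \<le> 0"
      unfolding null_r[symmetric] by (rule premeasure_mono)
    moreover have "F \<subseteq> U"
    proof
      fix x assume x: "x \<in> F"
      then have "x \<in> mspace X" "a x = 0" using subset a(2) by auto
      then show "x \<in> U" using pos[of x] r(1) by (auto simp: U_def h_def)
    qed
    moreover have "U \<subseteq> V"
    proof
      fix x assume x: "x \<in> U"
      show "x \<in> V"
      proof (rule ccontr)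
        assume "x \<notin> V"
        then have "b x = 0" using x b(2) by (auto simp: U_def)
        then have "0 \<le> h x" unfolding h_eq using x a(1) r(2) by (simp add: U_def)
        then show False using x by (simp add: U_def)
      qed
    qed
    ultimately show ?thesis using U by (intro exI[of _ U]) auto
  qed
qed

text \<open>Induction on p: the frontiers supplied by \<open>null_frontier_separation\<close> are
  null one dimension lower, for the same \<delta>, and are treated as metric spaces of their
  own.\<close>

theorem Ind_le_of_premeasure_zero:
  assumes "Hausdorff_premeasure X (real p) \<delta> (mspace X) = 0"
  shows "Ind_le (mtopology_of X) (int p - 1)"
  using assms
proof (induction p arbitrary: X)
  case 0
  then have "Hausdorff_premeasure X 0 \<delta> (mspace X) = 0" by simp
  then obtain U :: "nat \<Rightarrow> 'a set" where U: "mspace X \<subseteq> (\<Union>i. U i)" "(\<Sum>i. diam_pow X 0 (U i)) < 1"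
    by (rule premeasure_zeroD[OF _ zero_less_one])
  \<comment> \<open>In dimension 0 each nonempty covering set contributes 1, so a total below 1
    leaves only empty sets.\<close>
  have "U i = {}" for i
  proof (rule ccontr)
    assume "U i \<noteq> {}"
    then have "diam_pow X 0 (U i) = 1" by (simp add: diam_pow_def)
    then show False using ennreal_suminf_lessD[OF U(2), of i] by simp
  qed
  then show ?case using U(1) by (intro Ind_le.empty) auto
next
  case (Suc p)
  show ?case
  proof (rule Ind_le.step)
    fix F V assume FV: "closedin (mtopology_of X) F" "openin (mtopology_of X) V" "F \<subseteq> V"
    obtain U where U: "openin (mtopology_of X) U" "F \<subseteq> U" "U \<subseteq> V"
      "Hausdorff_premeasure X (real p) \<delta> (mtopology_of X frontier_of U) = 0"
      using null_frontier_separation[OF Suc.prems FV] by blast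
    define S where "S = mtopology_of X frontier_of U"
    have S: "S \<subseteq> mspace X" unfolding S_def using frontier_of_subset_topspace by fastforce
    have "Hausdorff_premeasure (submetric X S) (real p) \<delta> (mspace (submetric X S)) = 0"
      using premeasure_submetric[OF U(4)[folded S_def] S] S by (simp add: Int_absorb2)
    then have "Ind_le (subtopology (mtopology_of X) S) (int p - 1)"
      using Suc.IH by (simp add: mtopology_of_submetric[symmetric])
    then show "\<exists>U. openin (mtopology_of X) U \<and> F \<subseteq> U \<and> U \<subseteq> V \<and>
        Ind_le (subtopology (mtopology_of X) (mtopology_of X frontier_of U)) (int (Suc p) - 1 - 1)"
      using U(1-3) by (intro exI[of _ U]) (simp add: S_def)
  qed simp
qed

section \<open>From \<open>Ind\<close> to \<open>D\<close>\<close>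

lemma Ind_le_ge: "Ind_le X n \<Longrightarrow> topspace X \<noteq> {} \<Longrightarrow> 0 \<le> n"
  by (erule Ind_le.cases) auto

lemma D_dim_le_Ind_le:
  fixes X :: "'a topology"
  assumes "Ind_le X (int n)"
  shows "D_dim X \<le> Ord (ord_of_nat n)"
proof (cases "topspace X = {}")
  case True
  then show ?thesis by (simp add: D_dim_def)
next
  case False
  \<comment> \<open>A decomposition requires the finite part to equal \<open>Ind\<close> exactly, so
    the least bound m replaces n.\<close>
  define m where "m = (LEAST m. Ind_le X (int m))"
  have m: "Ind_le X (int m)" "m \<le> n"
    unfolding m_def using assms by (rule LeastI, rule Least_le)
  have le: "m \<le> nat k" if "Ind_le X k" for k
    unfolding m_def using that Ind_le_ge[OF that False] by (intro Least_le) simp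
  have Ind: "Ind X = ereal (real m)"
    unfolding Ind_def
  proof (rule antisym)
    show "(INF k\<in>{k. Ind_le X k}. ereal (real_of_int k)) \<le> ereal (real m)"
      using m(1) by (intro INF_lower2[of "int m"]) auto
    show "ereal (real m) \<le> (INF k\<in>{k. Ind_le X k}. ereal (real_of_int k))"
      using le Ind_le_ge[OF _ False] by (intro INF_greatest) force
  qed
  have zero: "{..0 :: 'a ord} = {0}"
    using zero_ordertype_le by (auto intro: antisym)
  have sub: "{\<delta>..0 :: 'a ord} = (if \<delta> = 0 then {0} else {})" for \<delta>
    using zero_ordertype_le by (auto intro: antisym)
  \<comment> \<open>The limit part of a finite ordinal is 0, so the whole space at index 0 is the
    only piece.\<close>
  have "D_decomposition X (ord_of_nat m) (\<lambda>_. topspace X)"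
    using False Ind zero_ordertype_le
    by (auto simp: D_decomposition_def limit_part_ord_of_nat finite_part_ord_of_nat zero sub)
  then have "D_dim X \<le> Ord (ord_of_nat m)"
    using False by (auto simp: D_dim_def intro!: Least_le)
  also have "\<dots> \<le> Ord (ord_of_nat n)"
    using m(2) strict_mono_less_eq[OF strict_mono_ord_of_nat[where 'a='a]] by simp
  finally show ?thesis .
qed


section \<open>Transfinite dimensions\<close>

lemma premeasure_eq_0_of_HD_less:
  assumes "HD X < ennreal t"
  shows "Hausdorff_premeasure X t 1 (mspace X) = 0"
proof -
  obtain s where s: "0 \<le> s" "Hausdorff_measure X s (mspace X) = 0" "ennreal s < ennreal t"
    using assms by (auto simp: HD_def INF_less_iff)
  have "Hausdorff_premeasure X t 1 (mspace X) \<le> Hausdorff_premeasure X s 1 (mspace X)"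
    using s by (intro premeasure_antimono_exponent) (auto simp: ennreal_less_iff)
  also have "\<dots> \<le> Hausdorff_measure X s (mspace X)"
    unfolding Hausdorff_measure_def by (rule SUP_upper) simp
  finally show ?thesis using s(2) by simp
qed

text \<open>\<Omega> bounds all the values, so the \<open>LEAST\<close> defining \<open>tDHD\<close>
  ranges over a nonempty set and is itself a bound.\<close>

lemma D_dim_Lipschitz_image_le_tDHD:
  fixes X Y :: "'a metric"
  assumes "E \<subseteq> mspace X" "Lipschitz_continuous_map (submetric X E) Y f"
  shows "D_dim (mtopology_of (submetric Y (f ` E))) \<le> tDHD X"
proof -
  let ?P = "\<lambda>v. \<forall>E (Y :: 'a metric) f. E \<subseteq> mspace X \<longrightarrow> Lipschitz_continuous_map (submetric X E) Y f \<longrightarrow>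
      D_dim (mtopology_of (submetric Y (f ` E))) \<le> v"
  have top: "v \<le> \<Omega>" for v :: "'a ord dimval" by (cases v) auto
  have "?P \<Omega>" by (intro allI impI top)
  then have "?P (LEAST v. ?P v)" by (rule LeastI[of ?P])
  then show ?thesis unfolding tDHD_def using assms by blast
qed

lemma D_dim_le_tDHD: "D_dim (mtopology_of X) \<le> tDHD X"
proof -
  \<comment> \<open>The identity exhibits the space as a Lipschitz image of itself.\<close>
  have "Lipschitz_continuous_map (submetric X (mspace X)) X id"
    by (auto simp: Lipschitz_continuous_map_def intro!: exI[of _ 1])
  then have "D_dim (mtopology_of (submetric X (id ` mspace X))) \<le> tDHD X"
    by (rule D_dim_Lipschitz_image_le_tDHD[OF order_refl])
  then show ?thesis by simp
qed

lemma tDHD_le: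
  assumes "HD X < ennreal (real (Suc n))"
  shows "tDHD X \<le> Ord (ord_of_nat n)"
  unfolding tDHD_def
proof (intro Least_le allI impI)
  fix E and Y :: "'a metric" and f
  assume E: "E \<subseteq> mspace X" and f: "Lipschitz_continuous_map (submetric X E) Y f"
  define Z where "Z = submetric Y (f ` E)"
  have E': "mspace (submetric X E) = E" using E by auto
  have fE: "f ` E \<subseteq> mspace Y" using Lipschitz_continuous_map_image[OF f] unfolding E' by auto
  then have Z: "mspace Z = f ` E" by (auto simp: Z_def)
  obtain B where B: "0 < B" "\<And>x y. x \<in> E \<Longrightarrow> y \<in> E \<Longrightarrow> mdist Y (f x) (f y) \<le> B * mdist X x y"
    using f unfolding Lipschitz_continuous_map_pos E' by auto
  have "Hausdorff_premeasure X (real (Suc n)) 1 E \<le> 0"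
    using premeasure_mono[OF E] premeasure_eq_0_of_HD_less[OF assms] by metis
  \<comment> \<open>The diameter bound changes from 1 to \<open>B\<close>;
    \<open>Ind_le_of_premeasure_zero\<close> accepts any bound.\<close>
  then have "Hausdorff_premeasure Z (real (Suc n)) (B * 1) (mspace Z) = 0"
    unfolding Z using E B fE by (intro premeasure_Lipschitz_image) (auto simp: Z Z_def)
  then have "Ind_le (mtopology_of Z) (int n)"
    using Ind_le_of_premeasure_zero by fastforce
  then show "D_dim (mtopology_of (submetric Y (f ` E))) \<le> Ord (ord_of_nat n)"
    unfolding Z_def by (rule D_dim_le_Ind_le)
qed

theorem theorem1p1:
  fixes X :: "'a metric"
  shows "(HD X < \<infinity> \<longrightarrow>
            D_dim (mtopology_of X) \<le> tDHD X \<and>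
            tDHD X \<le> Ord (ord_of_nat (nat \<lfloor>enn2real (HD X)\<rfloor>))) \<and>
         (Ord omega0 \<le> tDHD X \<longrightarrow> HD X = \<infinity>)"
proof -
  have le: "tDHD X \<le> Ord (ord_of_nat (nat \<lfloor>enn2real (HD X)\<rfloor>))" if "HD X < \<infinity>"
  proof (rule tDHD_le)
    \<comment> \<open>The floor plus one exceeds the dimension strictly, also when the dimension is
      an integer.\<close>
    have "enn2real (HD X) < real (Suc (nat \<lfloor>enn2real (HD X)\<rfloor>))"
      using enn2real_nonneg[of "HD X"] by linarith
    then show "HD X < ennreal (real (Suc (nat \<lfloor>enn2real (HD X)\<rfloor>)))"
      using that by simp
  qed
  moreover have "HD X = \<infinity>" if "Ord omega0 \<le> tDHD X"
  proof (rule ccontr)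
    assume "HD X \<noteq> \<infinity>"
    then have "HD X < \<infinity>" by (simp add: less_top)
    then have "Ord omega0 \<le> Ord (ord_of_nat (nat \<lfloor>enn2real (HD X)\<rfloor>) :: 'a ord)"
      using order_trans[OF that le] by simp
    moreover have "ord_of_nat (nat \<lfloor>enn2real (HD X)\<rfloor>) < (omega0 :: 'a ord)"
      by (rule ord_of_nat_less_omega0)
    ultimately show False by (simp add: leD)
  qed
  ultimately show ?thesis using D_dim_le_tDHD by blast
qed

end
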